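(* Let $x,y,z,q$ be complex numbers with $|q|<1$, $y\neq -q^{-n}/x$ and $y\neq zq^{-n}/x$ for all integers $n\ge1$. Define $$\Phi(x,y,z,q):=\sum_{n=0}^{\infty}\frac{x^{n}q^{n(n+1)/2}(-z;q)_{n}}{(-xyq;q)_{n}(q;q)_{n}},$$ and for each positive integer $m$ define $$g_m(x,y,z,q):=\sum_{n,j,l\ge0}x^{n}y^{j}z^{l}q^{n(n+1)/2+l(l-1)/2}\begin{bmatrix} m-1-n+j\\ j\end{bmatrix}\begin{bmatrix} m-1-j-l\\ n-j-l\end{bmatrix}\begin{bmatrix} m-1-n\\ l\end{bmatrix}.$$ Then for every integer $m\ge 2$, $$\sum_{n=0}^{\infty}\frac{x^{n}q^{n(n+1)/2+mn}(-z;q)_{n}}{(-xyq;q)_{m+n}(q;q)_{n}}=\frac{\Phi(xq^m,y,z,q)}{(-xyq;q)_{m}}=\frac{g_m(x,y,z,q)\,\Phi(xq,y,z,q)/(1+xyq)-g_{m-1}(xq,y,z,q)\,\Phi(x,y,z,q)}{\prod_{j=1}^{m-1}(x^2yq^{2j+1}-xzq^{j})}.$$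
   Context: $(a;q)_n=\prod_{k=0}^{n-1}(1-aq^k)$ for $n\ge 0$. The Gaussian polynomial $\begin{bmatrix} N\\ M\end{bmatrix}$ equals $\frac{(q;q)_N}{(q;q)_M(q;q)_{N-M}}$ if $0\le M\le N$ and $0$ otherwise (in particular it is $0$ when $N<0$ or $M<0$). All summation indices range over nonnegative integers. *)

theory Defs
  imports "HOL-Analysis.Analysis"
begin

definition qpoch :: "complex \<Rightarrow> complex \<Rightarrow> nat \<Rightarrow> complex" where
  "qpoch a q n = (\<Prod>k<n. 1 - a * q ^ k)"

text \<open>The arguments are integers because the upper and lower entries may become negative, in
  which case the Gaussian polynomial vanishes.\<close>
definition gauss :: "complex \<Rightarrow> int \<Rightarrow> int \<Rightarrow> complex" where
  "gauss q N M =
    (if 0 \<le> M \<and> M \<le> N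
     then qpoch q q (nat N) / (qpoch q q (nat M) * qpoch q q (nat (N - M)))
     else 0)"

definition Phi :: "complex \<Rightarrow> complex \<Rightarrow> complex \<Rightarrow> complex \<Rightarrow> complex" where
  "Phi x y z q =
    (\<Sum>n. x ^ n * q ^ (n * (n + 1) div 2) * qpoch (- z) q n
         / (qpoch (- x * y * q) q n * qpoch q q n))"

definition g_term ::
  "nat \<Rightarrow> complex \<Rightarrow> complex \<Rightarrow> complex \<Rightarrow> complex \<Rightarrow> nat \<Rightarrow> nat \<Rightarrow> nat \<Rightarrow> complex" where
  "g_term m x y z q n j l =
     x ^ n * y ^ j * z ^ l * q ^ (n * (n + 1) div 2 + l * (l - 1) div 2)
     * gauss q (int m - 1 - int n + int j) (int j)
     * gauss q (int m - 1 - int j - int l) (int n - int j - int l)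
     * gauss q (int m - 1 - int n) (int l)"

definition g ::
  "nat \<Rightarrow> complex \<Rightarrow> complex \<Rightarrow> complex \<Rightarrow> complex \<Rightarrow> complex" where
  "g m x y z q = (\<Sum>\<^sub>\<infinity>(n, j, l)\<in>UNIV. g_term m x y z q n j l)"

text \<open>The sum defining \<^const>\<open>g\<close> has finite support, and the series defining \<^const>\<open>Phi\<close> converges
  for \<open>|q| < 1\<close> (terms with a vanishing denominator being \<open>0\<close> by the convention \<open>a / 0 = 0\<close>).\<close>

lemma g_term_support:
  "{(n, j, l). g_term m x y z q n j l \<noteq> 0} \<subseteq> {..<m} \<times> {..<m} \<times> {..<m}"
  by (auto simp: g_term_def gauss_def split: if_splits)

lemma Phi_summable:
  fixes x y z q :: complex
  assumes q: "norm q < 1"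
  shows "summable (\<lambda>n. x ^ n * q ^ (n * (n + 1) div 2) * qpoch (- z) q n
         / (qpoch (- x * y * q) q n * qpoch q q n))"
    (is "summable ?t")
proof -
  define c where
    "c n = x * q ^ Suc n * (1 + z * q ^ n) / ((1 + x * y * q ^ Suc n) * (1 - q ^ Suc n))" for n
  have rec: "?t (Suc n) = c n * ?t n" for n
  proof -
    have "Suc n * (Suc n + 1) div 2 = n * (n + 1) div 2 + Suc n"
      by (simp add: algebra_simps)
    then show ?thesis
      by (simp add: c_def qpoch_def power_add mult_ac)
  qed
  have p: "(\<lambda>n. q ^ n) \<longlonglongrightarrow> 0"
    using q by (rule LIMSEQ_power_zero)
  have pS: "(\<lambda>n. q ^ Suc n) \<longlonglongrightarrow> 0"
    using p by (rule LIMSEQ_Suc)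
  have "c \<longlonglongrightarrow> x * 0 * (1 + z * 0) / ((1 + x * y * 0) * (1 - 0))"
    unfolding c_def by (intro tendsto_intros p pS) auto
  then have "c \<longlonglongrightarrow> 0" by simp
  then have "eventually (\<lambda>n. norm (c n) < 1 / 2) sequentially"
    using tendstoD[of c 0 sequentially "1 / 2"] by (simp add: dist_norm)
  then obtain N where N: "\<And>n. n \<ge> N \<Longrightarrow> norm (c n) < 1 / 2"
    by (auto simp: eventually_sequentially)
  show ?thesis
  proof (rule summable_ratio_test[of "1 / 2" N])
    fix n assume "N \<le> n"
    then have "norm (c n) * norm (?t n) \<le> 1 / 2 * norm (?t n)"
      by (intro mult_right_mono less_imp_le[OF N] norm_ge_zero)
    then show "norm (?t (Suc n)) \<le> 1 / 2 * norm (?t n)"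
      unfolding rec norm_mult[of "c n"] .
  qed simp
qed

end

theory Submission
  imports Defs
begin

text \<open>
  Put \<open>F\<^sub>k = \<Phi>(xq\<^sup>k, y, z, q) / (-xyq; q)\<^sub>k\<close> and \<open>c\<^sub>j = x\<^sup>2 y q\<^bsup>2j+1\<^esup> - x z q\<^sup>j\<close>. Telescoping gives the
  contiguous relation \<open>c\<^bsub>k+1\<^esub> F\<^bsub>k+2\<^esub> = (1 + x q\<^bsup>k+1\<^esup> + x y q\<^bsup>k+1\<^esup>) F\<^bsub>k+1\<^esub> - F\<^sub>k\<close>. The
  polynomials satisfy \<open>g\<^bsub>k+2\<^esub> = (1 + x q\<^bsup>k+1\<^esup> + x y q\<^bsup>k+1\<^esup>) g\<^bsub>k+1\<^esub> - c\<^sub>k g\<^sub>k\<close>, which holds already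
  coefficientwise, where it reduces to a rational identity in powers of \<open>q\<close>. The recurrence for
  \<open>g\<^bsub>k-1\<^esub>(xq, y, z, q)\<close> has the same coefficients, so both sides of
  \<open>c\<^sub>1 \<cdots> c\<^bsub>m-1\<^esub> F\<^sub>m = g\<^sub>m(x) F\<^sub>1 - g\<^bsub>m-1\<^esub>(xq) F\<^sub>0\<close> obey one second-order recurrence in \<open>m\<close>.
\<close>

section \<open>q-Pochhammer symbols\<close>

lemma qpoch_0 [simp]: "qpoch a q 0 = 1"
  by (simp add: qpoch_def)

lemma qpoch_Suc: "qpoch a q (Suc n) = qpoch a q n * (1 - a * q ^ n)"
  by (simp add: qpoch_def)

lemma qpoch_add: "qpoch a q (m + n) = qpoch a q m * qpoch (a * q ^ m) q n"
  by (induction n) (simp_all add: qpoch_Suc power_add mult_ac)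

lemma one_minus_power_nonzero:
  fixes q :: complex
  assumes "norm q < 1" "0 < n"
  shows "1 - q ^ n \<noteq> 0"
proof
  assume "1 - q ^ n = 0"
  then have "norm q ^ n = 1"
    by (metis eq_iff_diff_eq_0 norm_one norm_power)
  moreover have "norm q ^ n < 1"
    using assms by (simp add: power_less_one_iff)
  ultimately show False by simp
qed

lemma qpoch_self_nonzero:
  assumes "norm q < 1"
  shows "qpoch q q n \<noteq> 0"
proof (induction n)
  case (Suc n)
  then show ?case
    using one_minus_power_nonzero[OF assms, of "Suc n"] by (simp add: qpoch_Suc)
qed simp

lemma triangular_Suc: "Suc n * (Suc n + 1) div 2 = n * (n + 1) div 2 + Suc n"
  by (simp add: algebra_simps)

section \<open>Shifted series and the contiguous relation for \<open>Phi\<close>\<close>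

lemma Phi_sums:
  assumes "norm q < 1"
  shows "(\<lambda>n. x ^ n * q ^ (n * (n + 1) div 2) * qpoch (- z) q n
         / (qpoch (- x * y * q) q n * qpoch q q n)) sums Phi x y z q"
  unfolding Phi_def by (intro summable_sums Phi_summable assms)

text \<open>Termwise, \<open>q ^ (m * n)\<close> is absorbed into \<open>(x * q ^ m) ^ n\<close>,
  and the Pochhammer symbol of length \<open>m + n\<close> splits off its first \<open>m\<close>
  factors.\<close>

lemma Phi_shift_sums:
  assumes "norm q < 1"
  shows "(\<lambda>n. x ^ n * q ^ (n * (n + 1) div 2 + m * n) * qpoch (- z) q n
            / (qpoch (- x * y * q) q (m + n) * qpoch q q n))
          sums (Phi (x * q ^ m) y z q / qpoch (- x * y * q) q m)"
proof -
  have "(x * q ^ m) ^ n * q ^ (n * (n + 1) div 2) * qpoch (- z) q n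
         / (qpoch (- (x * q ^ m) * y * q) q n * qpoch q q n) / qpoch (- x * y * q) q m
      = x ^ n * q ^ (n * (n + 1) div 2 + m * n) * qpoch (- z) q n
            / (qpoch (- x * y * q) q (m + n) * qpoch q q n)" for n
    by (simp add: qpoch_add power_mult_distrib power_add power_mult mult_ac)
  then show ?thesis
    using sums_divide[OF Phi_sums[OF assms, of "x * q ^ m" z y], of "qpoch (- x * y * q) q m"]
    by simp
qed

text \<open>Creative telescoping: termwise the combination equals \<open>R (Suc n) - R n\<close>,
  where \<open>R 0 = 0\<close> because of the factor \<open>1 - q ^ n\<close>, and
  \<open>R n\<close> tends to 0 because the terms of a convergent series do.\<close>

lemma Phi_contiguous:
  fixes x y z q :: complex
  assumes q: "norm q < 1" and nz: "\<And>n. n \<ge> 1 \<Longrightarrow> 1 + x * y * q ^ n \<noteq> 0"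
  shows "Phi x y z q = (1 + x * q + x * y * q) * (Phi (x * q) y z q / (1 + x * y * q))
     + (x * z * q - x\<^sup>2 * y * q ^ 3) * (Phi (x * q\<^sup>2) y z q / ((1 + x * y * q) * (1 + x * y * q\<^sup>2)))"
proof -
  define A where "A n = x ^ n * q ^ (n * (n + 1) div 2) * qpoch (- z) q n
         / (qpoch (- x * y * q) q n * qpoch q q n)" for n
  define t where "t m n = x ^ n * q ^ (n * (n + 1) div 2 + m * n) * qpoch (- z) q n
            / (qpoch (- x * y * q) q (m + n) * qpoch q q n)" for m n
  define w where "w = x * y * q"
  \<comment> \<open>The antidifference of the combination of series terms in \<open>tele\<close>.\<close>
  define R where "R n = - (A n * (1 - q ^ n) / (1 + w * q ^ n))" for n
  have w: "1 + w * q ^ n \<noteq> 0" for n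
    using nz[of "Suc n"] by (simp add: w_def mult_ac)
  have A_sums: "A sums Phi x y z q"
    unfolding A_def by (rule Phi_sums[OF q])
  have t_sums: "t m sums (Phi (x * q ^ m) y z q / qpoch (- x * y * q) q m)" for m
    unfolding t_def by (rule Phi_shift_sums[OF q])
  have A_Suc: "A (Suc n) = A n * (x * q * q ^ n * (1 + z * q ^ n)) /
      ((1 + w * q ^ n) * (1 - q * q ^ n))" for n
    unfolding A_def triangular_Suc
    by (simp add: qpoch_Suc power_add w_def mult_ac)
  have t1: "t 1 n = A n * q ^ n / (1 + w * q ^ n)" for n
    by (simp add: t_def A_def qpoch_Suc power_add w_def mult_ac)
  have t2: "t 2 n = A n * (q ^ n)\<^sup>2 / ((1 + w * q ^ n) * (1 + w * q * q ^ n))" for n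
    by (simp add: t_def A_def qpoch_Suc power_add w_def mult_ac numeral_2_eq_2)
  have tele: "A n - (1 + x * q + x * y * q) * t 1 n - (x * z * q - x\<^sup>2 * y * q ^ 3) * t 2 n
      = R (Suc n) - R n" for n
  proof -
    define N where "N = q ^ n"
    have n1: "1 + w * N \<noteq> 0" "1 + w * q * N \<noteq> 0" "1 - q * N \<noteq> 0"
      using w[of n] w[of "Suc n"] one_minus_power_nonzero[OF q, of "Suc n"]
      by (simp_all add: N_def mult_ac)
    have c: "x * z * q - x\<^sup>2 * y * q ^ 3 = x * z * q - w * x * q\<^sup>2"
      by (simp add: w_def power2_eq_square power3_eq_cube)
    \<comment> \<open>The factor \<open>1 - q * N\<close> of \<open>R (Suc n)\<close> cancels the
      one in the denominator of \<open>A (Suc n)\<close>.\<close>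
    have "R (Suc n) - R n = A n * (1 - N) / (1 + w * N)
        - A n * (x * q * N * (1 + z * N)) / ((1 + w * N) * (1 + w * q * N))"
      using n1 by (simp add: R_def A_Suc N_def[symmetric] mult_ac)
    also have "\<dots> = A n * ((1 - N) * (1 + w * q * N) - x * q * N * (1 + z * N))
        / ((1 + w * N) * (1 + w * q * N))"
      using n1 by (simp add: divide_simps) (simp add: algebra_simps)
    \<comment> \<open>The numerator is split so that its three parts, over the common denominator,
      are the terms of the three series.\<close>
    also have "(1 - N) * (1 + w * q * N) - x * q * N * (1 + z * N)
      = (1 + w * N) * (1 + w * q * N) - (1 + x * q + w) * N * (1 + w * q * N)
        - (x * z * q - w * x * q\<^sup>2) * N\<^sup>2"
      by (simp add: algebra_simps power2_eq_square)
    also have "A n * \<dots> / ((1 + w * N) * (1 + w * q * N))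
      = A n - (1 + x * q + w) * (A n * N / (1 + w * N))
        - (x * z * q - w * x * q\<^sup>2) * (A n * N\<^sup>2 / ((1 + w * N) * (1 + w * q * N)))"
      using n1 by (simp add: divide_simps) (simp add: algebra_simps)
    finally show ?thesis
      unfolding t1 t2 c by (simp add: N_def w_def)
  qed
  have "A \<longlonglongrightarrow> 0"
    using A_sums by (intro summable_LIMSEQ_zero sums_summable)
  then have "R \<longlonglongrightarrow> - (0 * (1 - 0) / (1 + w * 0))"
    unfolding R_def by (intro tendsto_intros LIMSEQ_power_zero q) auto
  then have "(\<lambda>n. R (Suc n) - R n) sums (0 - R 0)"
    by (intro telescope_sums) simp
  then have "(\<lambda>n. A n - (1 + x * q + x * y * q) * t 1 n - (x * z * q - x\<^sup>2 * y * q ^ 3) * t 2 n) sums 0"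
    by (simp only: tele) (simp add: R_def)
  moreover have "(\<lambda>n. A n - (1 + x * q + x * y * q) * t 1 n - (x * z * q - x\<^sup>2 * y * q ^ 3) * t 2 n)
     sums (Phi x y z q - (1 + x * q + x * y * q) * (Phi (x * q ^ 1) y z q / qpoch (- x * y * q) q 1)
       - (x * z * q - x\<^sup>2 * y * q ^ 3) * (Phi (x * q ^ 2) y z q / qpoch (- x * y * q) q 2))"
    by (intro sums_diff sums_mult A_sums t_sums)
  ultimately have "0 = Phi x y z q - (1 + x * q + x * y * q) * (Phi (x * q ^ 1) y z q / qpoch (- x * y * q) q 1)
       - (x * z * q - x\<^sup>2 * y * q ^ 3) * (Phi (x * q ^ 2) y z q / qpoch (- x * y * q) q 2)"
    by (rule sums_unique2)
  moreover have "qpoch (- x * y * q) q 1 = 1 + x * y * q"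
    "qpoch (- x * y * q) q 2 = (1 + x * y * q) * (1 + x * y * q\<^sup>2)"
    by (simp_all add: qpoch_def numeral_2_eq_2 mult_ac)
  ultimately show ?thesis by (simp add: algebra_simps)
qed

section \<open>Coefficients of \<open>g\<close> and their recurrence\<close>

lemma gauss_of_nat:
  "gauss q (int (a + b)) (int a) = qpoch q q (a + b) / (qpoch q q a * qpoch q q b)"
  by (simp add: gauss_def nat_int_add)

text \<open>The second Gaussian polynomial vanishes unless \<open>j + l \<le> n\<close>, the third
  unless \<open>n + l < m\<close>.\<close>

lemma g_term_eq_0:
  assumes "\<not> (j + l \<le> n \<and> n + l < m)"
  shows "g_term m x y z q n j l = 0"
  using assms by (auto simp: g_term_def gauss_def)

text \<open>On the support of \<^const>\<open>g_term\<close> write \<open>n = j + l + p\<close> and \<open>m - 1 = n + l + s\<close>; in the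
  coordinates \<open>j, l, p, s\<close> all five terms of the recurrence for \<^const>\<open>g\<close> are unit shifts.\<close>

definition g_coeff :: "complex \<Rightarrow> complex \<Rightarrow> complex \<Rightarrow> complex \<Rightarrow> nat \<Rightarrow> nat \<Rightarrow> nat \<Rightarrow> nat \<Rightarrow> complex"
  where "g_coeff x y z q j l p s =
    x ^ (j + l + p) * y ^ j * z ^ l
    * (q ^ ((j + l + p) * (j + l + p + 1) div 2) * q ^ (l * (l - 1) div 2))
    * (qpoch q q (j + l + s) * qpoch q q (l + p + s))
    / (qpoch q q j * qpoch q q (l + s) * qpoch q q p * qpoch q q l * qpoch q q s)"

text \<open>The numerator \<open>qpoch q q (l + s)\<close> of the third Gaussian polynomial cancels
  one of the two equal factors in the denominators of the others.\<close>

lemma g_term_eq_g_coeff: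
  assumes "norm q < 1" "n = j + l + p" "m = Suc (j + 2 * l + p + s)"
  shows "g_term m x y z q n j l = g_coeff x y z q j l p s"
proof -
  have "int m - 1 - int n + int j = int (j + (l + s))"
    "int m - 1 - int j - int l = int (p + (l + s))" "int n - int j - int l = int p"
    "int m - 1 - int n = int (l + s)"
    using assms by simp_all
  then show ?thesis
    using qpoch_self_nonzero[OF assms(1)] assms(2)
    by (simp only: g_term_def gauss_of_nat) (simp add: g_coeff_def power_add field_simps add_ac)
qed

text \<open>Each shifted coefficient is \<open>?H\<close> times a rational function of
  \<open>q ^ j\<close>, \<open>q ^ l\<close>, \<open>q ^ p\<close>, \<open>q ^ s\<close>.
  Multiplying by \<open>U * V\<close> clears the denominators and leaves a polynomial
  identity.\<close>

lemma g_coeff_rec: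
  fixes x y z q :: complex
  assumes q: "norm q < 1" and m: "m = j + 2 * l + p + s" "m > 0"
  shows "g_coeff x y z q j l p s =
     (if s = 0 then 0 else g_coeff x y z q j l p (s - 1))
   + x * q ^ m * (if p = 0 then 0 else g_coeff x y z q j l (p - 1) s)
   + x * y * q ^ m * (if j = 0 then 0 else g_coeff x y z q (j - 1) l p s)
   - x\<^sup>2 * y * q ^ (2 * m - 1) * (if j = 0 \<or> p = 0 then 0 else g_coeff x y z q (j - 1) l (p - 1) s)
   + x * z * q ^ (m - 1) * (if l = 0 then 0 else g_coeff x y z q j (l - 1) p s)"
    (is "?H = ?T1 + ?T2 + ?T3 - ?T4 + ?T5")
proof -
  \<comment> \<open>The last factors of the two Pochhammer symbols in the numerator, lost when an
    index in them drops by one.\<close>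
  define U V where "U = 1 - q ^ (j + l + s)" and "V = 1 - q ^ (l + p + s)"
  define P where "P = qpoch q q"
  define r where "r n = inverse (qpoch q q n)" for n
  define e where "e n = q ^ (n * (n + 1) div 2)" for n
  define f where "f n = q ^ (n * (n - 1) div 2)" for n
  have H: "g_coeff x y z q j l p s = x ^ (j + l + p) * y ^ j * z ^ l * e (j + l + p) * f l
      * P (j + l + s) * P (l + p + s) * r j * r (l + s) * r p * r l * r s" for j l p s
    by (simp only: g_coeff_def divide_inverse inverse_mult_distrib e_def f_def P_def r_def mult_ac)
  have P: "P (Suc n) = P n * (1 - q ^ Suc n)" for n
    by (simp add: P_def qpoch_Suc)
  have r: "r n = (1 - q ^ Suc n) * r (Suc n)" for n
    using one_minus_power_nonzero[OF q, of "Suc n"]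
    by (simp add: r_def qpoch_Suc del: power_Suc) (simp add: field_simps)
  have e: "e (Suc n) = e n * q ^ Suc n" for n
    unfolding e_def triangular_Suc by (simp only: power_add)
  have f: "f (Suc n) = f n * q ^ n" for n
  proof -
    have "Suc n * (Suc n - 1) div 2 = n * (n - 1) div 2 + n"
      by (cases n) (simp_all add: algebra_simps)
    then show ?thesis unfolding f_def by (simp only: power_add)
  qed
  \<comment> \<open>In T1 to T5 a lowered index equal to 0 needs no correction: the guard makes the
    left side 0, and a factor such as \<open>1 - q ^ s\<close> does the same on the right.\<close>
  have T1: "U * V * ?T1 = (1 - q ^ (l + s)) * (1 - q ^ s) * ?H"
  proof (cases s)
    case (Suc s')
    show ?thesis
      unfolding H U_def V_def
      by (simp add: Suc P r[of s'] r[of "l + s'"] mult_ac del: power_Suc)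
  qed simp
  have T2: "V * ?T2 = q ^ (l + s) * (1 - q ^ p) * ?H"
  proof (cases p)
    case (Suc p')
    \<comment> \<open>Here \<open>m\<close> is the \<open>x\<close>-degree plus
      \<open>l + s\<close>; the first part restores the triangular exponent \<open>e\<close> at the
      unshifted degree.\<close>
    have "q ^ m = q ^ Suc (j + l + p') * q ^ (l + s)"
      by (simp add: m Suc power_add mult_2)
    then show ?thesis
      unfolding H V_def
      by (simp add: Suc P r[of p'] e mult_ac del: power_Suc)
        (simp add: mult_ac)
  qed simp
  have T3: "U * ?T3 = q ^ (l + s) * (1 - q ^ j) * ?H"
  proof (cases j)
    case (Suc j')
    have "q ^ m = q ^ Suc (j' + l + p) * q ^ (l + s)"
      by (simp add: m Suc power_add mult_2)
    then show ?thesis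
      unfolding H U_def
      by (simp add: Suc P r[of j'] e mult_ac del: power_Suc)
        (simp add: mult_ac)
  qed simp
  have T4: "U * V * ?T4 = q ^ (l + s) * q ^ (l + s) * (1 - q ^ j) * (1 - q ^ p) * ?H"
  proof (cases "j = 0 \<or> p = 0")
    case False
    then obtain j' p' where jp: "j = Suc j'" "p = Suc p'"
      by (meson not0_implies_Suc)
    have "2 * m - 1 = Suc (j' + l + p') + Suc (Suc (j' + l + p')) + (l + s) + (l + s)"
      by (simp add: m jp)
    then have "q ^ (2 * m - 1) = q ^ Suc (j' + l + p') * q ^ Suc (Suc (j' + l + p')) * q ^ (l + s) * q ^ (l + s)"
      by (simp only: power_add)
    then show ?thesis
      unfolding H U_def V_def
      by (simp add: jp P r[of p'] r[of j'] e mult_ac del: power_Suc)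
        (simp add: mult_ac power2_eq_square)
  qed auto
  have T5: "U * V * ?T5 = q ^ s * (1 - q ^ (l + s)) * (1 - q ^ l) * ?H"
  proof (cases l)
    case (Suc l')
    \<comment> \<open>The three summands restore \<open>e\<close>, restore \<open>f\<close>, and
      leave \<open>q ^ s\<close>.\<close>
    have "m - 1 = Suc (j + l' + p) + l' + s"
      by (simp add: m Suc)
    then have "q ^ (m - 1) = q ^ Suc (j + l' + p) * q ^ l' * q ^ s"
      by (simp only: power_add)
    then show ?thesis
      unfolding H U_def V_def
      by (simp add: Suc P r[of l'] r[of "l' + s"] e f mult_ac del: power_Suc)
        (simp add: mult_ac)
  qed simp
  show ?thesis
  proof (cases "l + s = 0 \<and> (j = 0 \<or> p = 0)")
    \<comment> \<open>Here \<open>U\<close> or \<open>V\<close> is 0 and cannot be cancelled. Only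
      \<open>p\<close> or \<open>j\<close> is positive and it equals \<open>m\<close>, so just
      \<open>?T2\<close> or \<open>?T3\<close> survives and equals \<open>?H\<close>.\<close>
    case True
    then show ?thesis
      using T1 T2 T3 T4 T5 m one_minus_power_nonzero[OF q, of m]
      by (auto simp: U_def V_def)
  next
    case False
    then have UV: "U \<noteq> 0" "V \<noteq> 0"
      using one_minus_power_nonzero[OF q, of "j + l + s"] one_minus_power_nonzero[OF q, of "l + p + s"]
      unfolding U_def V_def by auto
    define Q J L N W where "Q = q ^ (l + s)" "J = q ^ j" "L = q ^ l" "N = q ^ p" "W = q ^ s"
    have U: "U = 1 - J * Q" and V: "V = 1 - N * Q" and Q: "Q = L * W"
      by (simp_all add: U_def V_def Q_J_L_N_W_def power_add)
    have "U * V * (?T1 + ?T2 + ?T3 - ?T4 + ?T5)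
        = U * V * ?T1 + U * (V * ?T2) + V * (U * ?T3) - U * V * ?T4 + U * V * ?T5"
      by (simp only: ring_distribs mult_ac)
    also have "\<dots> = ((1 - Q) * (1 - W) + U * (Q * (1 - N)) + V * (Q * (1 - J))
        - Q * Q * (1 - J) * (1 - N) + W * (1 - Q) * (1 - L)) * ?H"
      unfolding T1 T2 T3 T4 T5 by (simp add: Q_J_L_N_W_def algebra_simps)
    \<comment> \<open>As \<open>L * W = Q\<close>, the outer terms add up to
      \<open>(1 - Q)\<^sup>2\<close>. With \<open>a = Q * (1 - J)\<close> and
      \<open>b = Q * (1 - N)\<close> one has \<open>U = 1 - Q + a\<close> and
      \<open>V = 1 - Q + b\<close>, and the rest is \<open>U * b + V * a - a * b\<close>.\<close>
    also have "(1 - Q) * (1 - W) + U * (Q * (1 - N)) + V * (Q * (1 - J))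
        - Q * Q * (1 - J) * (1 - N) + W * (1 - Q) * (1 - L) = U * V"
      unfolding U V Q by (simp add: algebra_simps)
    finally show ?thesis
      using UV by simp
  qed
qed

lemma g_term_rec:
  fixes x y z q :: complex
  assumes q: "norm q < 1"
  shows "g_term (Suc (Suc k)) x y z q n j l =
     g_term (Suc k) x y z q n j l
   + x * q ^ Suc k * (if n \<ge> 1 then g_term (Suc k) x y z q (n - 1) j l else 0)
   + x * y * q ^ Suc k * (if n \<ge> 1 \<and> j \<ge> 1 then g_term (Suc k) x y z q (n - 1) (j - 1) l else 0)
   - x\<^sup>2 * y * q ^ (2 * k + 1) * (if n \<ge> 2 \<and> j \<ge> 1 then g_term k x y z q (n - 2) (j - 1) l else 0)
   + x * z * q ^ k * (if n \<ge> 1 \<and> l \<ge> 1 then g_term k x y z q (n - 1) j (l - 1) else 0)"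
proof (cases "j + l \<le> n \<and> n + l \<le> Suc k")
  case False
  \<comment> \<open>Every shift maps the complement of the support into the complement of the
    smaller support.\<close>
  have "g_term (Suc (Suc k)) x y z q n j l = 0" "g_term (Suc k) x y z q n j l = 0"
    "(if n \<ge> 1 then g_term (Suc k) x y z q (n - 1) j l else 0) = 0"
    "(if n \<ge> 1 \<and> j \<ge> 1 then g_term (Suc k) x y z q (n - 1) (j - 1) l else 0) = 0"
    "(if n \<ge> 2 \<and> j \<ge> 1 then g_term k x y z q (n - 2) (j - 1) l else 0) = 0"
    "(if n \<ge> 1 \<and> l \<ge> 1 then g_term k x y z q (n - 1) j (l - 1) else 0) = 0"
    using False by (auto intro!: g_term_eq_0)
  then show ?thesis by (simp only: mult_zero_right add_0_right diff_0_right)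
next
  case True
  define p s where "p = n - j - l" and "s = Suc k - n - l"
  have n: "n = j + l + p" and k: "Suc k = j + 2 * l + p + s"
    using True by (auto simp: p_def s_def)
  note G = g_term_eq_g_coeff[OF q]
  have "g_term (Suc (Suc k)) x y z q n j l = g_coeff x y z q j l p s"
    using n k by (intro G) simp_all
  moreover have "g_term (Suc k) x y z q n j l = (if s = 0 then 0 else g_coeff x y z q j l p (s - 1))"
    using n k by (auto intro!: G g_term_eq_0)
  moreover have "(if n \<ge> 1 then g_term (Suc k) x y z q (n - 1) j l else 0)
      = (if p = 0 then 0 else g_coeff x y z q j l (p - 1) s)"
    using n k by (auto intro!: G g_term_eq_0)
  moreover have "(if n \<ge> 1 \<and> j \<ge> 1 then g_term (Suc k) x y z q (n - 1) (j - 1) l else 0)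
      = (if j = 0 then 0 else g_coeff x y z q (j - 1) l p s)"
    using n k by (auto intro!: G g_term_eq_0)
  moreover have "(if n \<ge> 2 \<and> j \<ge> 1 then g_term k x y z q (n - 2) (j - 1) l else 0)
      = (if j = 0 \<or> p = 0 then 0 else g_coeff x y z q (j - 1) l (p - 1) s)"
    using n k by (auto intro!: G g_term_eq_0)
  moreover have "(if n \<ge> 1 \<and> l \<ge> 1 then g_term k x y z q (n - 1) j (l - 1) else 0)
      = (if l = 0 then 0 else g_coeff x y z q j (l - 1) p s)"
    using n k by (auto intro!: G g_term_eq_0)
  ultimately show ?thesis
    using g_coeff_rec[OF q k, of x y z] by simp
qed

section \<open>Recurrence and initial values of \<open>g\<close>\<close>

text \<open>Translation of the indices is injective, and the guarded summand vanishes off its range;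
  so multiplying by a monomial leaves the coefficient sum unchanged.\<close>

lemma has_sum_shift3:
  fixes F :: "nat \<Rightarrow> nat \<Rightarrow> nat \<Rightarrow> complex"
  assumes "((\<lambda>(n, j, l). F n j l) has_sum S) UNIV"
  shows "((\<lambda>(n, j, l). if n \<ge> a \<and> j \<ge> b \<and> l \<ge> c then F (n - a) (j - b) (l - c) else 0) has_sum S) UNIV"
proof -
  define h where "h = (\<lambda>(n, j, l). (n + a, j + b, l + c))"
  let ?G = "\<lambda>(n, j, l). if n \<ge> a \<and> j \<ge> b \<and> l \<ge> c then F (n - a) (j - b) (l - c) else 0"
  have "inj h"
    by (auto simp: h_def inj_def)
  moreover have "?G \<circ> h = (\<lambda>(n, j, l). F n j l)"
    by (auto simp: h_def fun_eq_iff)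
  ultimately have "(?G has_sum S) (range h)"
    using assms by (simp add: has_sum_reindex)
  moreover have "t \<in> range h" if "?G t \<noteq> 0" for t
  proof -
    obtain n j l where t: "t = (n, j, l)" by (cases t)
    have "t = h (n - a, j - b, l - c)"
      using that by (auto simp: h_def t split: if_splits)
    then show ?thesis by blast
  qed
  ultimately show ?thesis
    by (subst has_sum_cong_neutral[where T = "range h" and g = ?G]) auto
qed

lemma g_has_sum: "((\<lambda>(n, j, l). g_term m x y z q n j l) has_sum g m x y z q) UNIV"
proof -
  have "(\<lambda>(n, j, l). g_term m x y z q n j l) summable_on UNIV"
  proof (rule finite_nonzero_values_imp_summable_on)
    show "finite {t \<in> UNIV. (case t of (n, j, l) \<Rightarrow> g_term m x y z q n j l) \<noteq> 0}"
      by (rule finite_subset[OF _ finite_cartesian_product[of "{..<m}" "{..<m} \<times> {..<m}"]])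
        (use g_term_support[of m x y z q] in auto)
  qed
  then show ?thesis
    unfolding g_def by simp
qed

lemma g_rec:
  fixes x y z q :: complex
  assumes q: "norm q < 1"
  shows "g (Suc (Suc k)) x y z q = (1 + x * q ^ Suc k + x * y * q ^ Suc k) * g (Suc k) x y z q
     - (x\<^sup>2 * y * q ^ (2 * k + 1) - x * z * q ^ k) * g k x y z q"
proof -
  note h = has_sum_shift3[OF g_has_sum[of _ x y z q]]
  \<comment> \<open>The trivial guards and \<open>- 0\<close> fit the shape of
    \<open>has_sum_shift3\<close>.\<close>
  have "((\<lambda>t. (case t of (n, j, l) \<Rightarrow> g_term (Suc k) x y z q n j l)
   + x * q ^ Suc k * (case t of (n, j, l) \<Rightarrow> if n \<ge> 1 \<and> j \<ge> 0 \<and> l \<ge> 0 then g_term (Suc k) x y z q (n - 1) (j - 0) (l - 0) else 0)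
   + x * y * q ^ Suc k * (case t of (n, j, l) \<Rightarrow> if n \<ge> 1 \<and> j \<ge> 1 \<and> l \<ge> 0 then g_term (Suc k) x y z q (n - 1) (j - 1) (l - 0) else 0)
   + - (x\<^sup>2 * y * q ^ (2 * k + 1)) * (case t of (n, j, l) \<Rightarrow> if n \<ge> 2 \<and> j \<ge> 1 \<and> l \<ge> 0 then g_term k x y z q (n - 2) (j - 1) (l - 0) else 0)
   + x * z * q ^ k * (case t of (n, j, l) \<Rightarrow> if n \<ge> 1 \<and> j \<ge> 0 \<and> l \<ge> 1 then g_term k x y z q (n - 1) (j - 0) (l - 1) else 0))
   has_sum (g (Suc k) x y z q + x * q ^ Suc k * g (Suc k) x y z q + x * y * q ^ Suc k * g (Suc k) x y z q
     + - (x\<^sup>2 * y * q ^ (2 * k + 1)) * g k x y z q + x * z * q ^ k * g k x y z q)) UNIV"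
    (is "(?f has_sum _) _")
    by (intro has_sum_add has_sum_cmult_right g_has_sum h)
  also have "?f = (\<lambda>(n, j, l). g_term (Suc (Suc k)) x y z q n j l)"
    by (rule ext) (simp add: g_term_rec[OF q, of k] split: prod.split)
  finally have "g (Suc (Suc k)) x y z q = g (Suc k) x y z q + x * q ^ Suc k * g (Suc k) x y z q
     + x * y * q ^ Suc k * g (Suc k) x y z q
     + - (x\<^sup>2 * y * q ^ (2 * k + 1)) * g k x y z q + x * z * q ^ k * g k x y z q"
    by (rule has_sum_unique[OF g_has_sum])
  then show ?thesis by (simp add: algebra_simps)
qed

text \<open>The support is empty. With this value the recurrence can start at index 0 and yields
  \<open>g\<close> at 2.\<close>

lemma g_0: "g 0 x y z q = 0"
  unfolding g_def by (intro infsum_0) (auto simp: g_term_eq_0)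

lemma g_1: "g (Suc 0) x y z q = 1"
proof -
  have "((\<lambda>(n, j, l). g_term (Suc 0) x y z q n j l) has_sum (g_term (Suc 0) x y z q 0 0 0)) {(0, 0, 0)}"
    using has_sum_finite[of "{(0, 0, 0)}" "\<lambda>(n, j, l). g_term (Suc 0) x y z q n j l"] by simp
  then have "((\<lambda>(n, j, l). g_term (Suc 0) x y z q n j l) has_sum (g_term (Suc 0) x y z q 0 0 0)) UNIV"
    by (subst has_sum_cong_neutral[where T = "{(0, 0, 0)}"])
      (use g_term_support[of "Suc 0" x y z q] in auto)
  then have "g (Suc 0) x y z q = g_term (Suc 0) x y z q 0 0 0"
    by (rule has_sum_unique[OF g_has_sum])
  then show ?thesis
    by (simp add: g_term_def gauss_def)
qed

section \<open>The common recurrence in \<open>m\<close> and the closed form\<close>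

text \<open>The contiguous relation at \<open>x * q ^ k\<close>, divided by
  \<open>qpoch (- x * y * q) q k\<close>.\<close>

lemma Phi_shift_rec:
  fixes x y z q :: complex
  assumes q: "norm q < 1" and nz: "\<And>n. n \<ge> 1 \<Longrightarrow> 1 + x * y * q ^ n \<noteq> 0"
  defines "F \<equiv> \<lambda>k. Phi (x * q ^ k) y z q / qpoch (- x * y * q) q k"
  shows "(x\<^sup>2 * y * q ^ (2 * Suc k + 1) - x * z * q ^ Suc k) * F (Suc (Suc k))
    = (1 + x * q ^ Suc k + x * y * q ^ Suc k) * F (Suc k) - F k"
proof -
  define X where "X = x * q ^ k"
  define D where "D = qpoch (- x * y * q) q k"
  have nzX: "1 + X * y * q ^ n \<noteq> 0" if "n \<ge> 1" for n
    using nz[of "k + n"] that by (simp add: X_def power_add mult_ac)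
  have F: "F k = Phi X y z q / D" "F (Suc k) = Phi (X * q) y z q / (1 + X * y * q) / D"
    "F (Suc (Suc k)) = Phi (X * q\<^sup>2) y z q / ((1 + X * y * q) * (1 + X * y * q\<^sup>2)) / D"
    by (simp_all add: F_def X_def D_def qpoch_Suc power2_eq_square mult_ac)
  have c: "x * q ^ Suc k = X * q" "x * y * q ^ Suc k = X * y * q"
    "x\<^sup>2 * y * q ^ (2 * Suc k + 1) - x * z * q ^ Suc k = - (X * z * q - X\<^sup>2 * y * q ^ 3)"
    by (simp_all add: X_def power_mult_distrib power_add power2_eq_square power3_eq_cube
        mult_2 mult_2_right mult_ac)
  have "F k = (1 + X * q + X * y * q) * F (Suc k) + (X * z * q - X\<^sup>2 * y * q ^ 3) * F (Suc (Suc k))"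
    unfolding F by (subst Phi_contiguous[OF q nzX]) (simp_all add: add_divide_distrib)
  then show ?thesis
    unfolding c by (simp add: algebra_simps)
qed

lemma Phi_shift_eq:
  fixes x y z q :: complex
  assumes q: "norm q < 1" and nz: "\<And>n. n \<ge> 1 \<Longrightarrow> 1 + x * y * q ^ n \<noteq> 0"
  defines "F \<equiv> \<lambda>k. Phi (x * q ^ k) y z q / qpoch (- x * y * q) q k"
    and "c \<equiv> \<lambda>j. x\<^sup>2 * y * q ^ (2 * j + 1) - x * z * q ^ j"
  shows "(\<Prod>j=1..k. c j) * F (Suc k) = g (Suc k) x y z q * F 1 - g k (x * q) y z q * F 0"
proof (induction k rule: induct_nat_012)
  case 0
  then show ?case by (simp add: g_0 g_1)
next
  case 1
  have "c 1 * F 2 = (1 + x * q + x * y * q) * F 1 - F 0"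
    using Phi_shift_rec[OF q nz, of 0 z] by (simp add: F_def c_def numeral_2_eq_2)
  then show ?case
    by (simp add: g_rec[OF q] g_0 g_1 numeral_2_eq_2)
next
  case (ge2 k)
  define a where "a = 1 + x * q ^ Suc (Suc k) + x * y * q ^ Suc (Suc k)"
  have rec: "c (Suc (Suc k)) * F (Suc (Suc (Suc k))) = a * F (Suc (Suc k)) - F (Suc k)"
    unfolding F_def c_def a_def by (rule Phi_shift_rec[OF q nz])
  have gx: "g (Suc (Suc (Suc k))) x y z q = a * g (Suc (Suc k)) x y z q - c (Suc k) * g (Suc k) x y z q"
    by (subst g_rec[OF q]) (simp add: a_def c_def)
  \<comment> \<open>Replacing \<open>x\<close> by \<open>x * q\<close> raises the index in the
    coefficients by one, which offsets the lower index of \<open>g\<close>.\<close>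
  have gxq: "g (Suc (Suc k)) (x * q) y z q = a * g (Suc k) (x * q) y z q - c (Suc k) * g k (x * q) y z q"
    by (subst g_rec[OF q]) (simp add: a_def c_def power2_eq_square algebra_simps)
  have "(\<Prod>j=1..Suc (Suc k). c j) * F (Suc (Suc (Suc k)))
      = (\<Prod>j=1..Suc k. c j) * (c (Suc (Suc k)) * F (Suc (Suc (Suc k))))"
    by simp
  also have "\<dots> = a * ((\<Prod>j=1..Suc k. c j) * F (Suc (Suc k))) - c (Suc k) * ((\<Prod>j=1..k. c j) * F (Suc k))"
    unfolding rec by (simp add: algebra_simps)
  also have "\<dots> = g (Suc (Suc (Suc k))) x y z q * F 1 - g (Suc (Suc k)) (x * q) y z q * F 0"
    unfolding ge2 gx gxq by (simp add: algebra_simps)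
  finally show ?case .
qed

theorem theorem3p2:
  fixes x y z q :: complex and m :: nat
  assumes "norm q < 1"
    and "x \<noteq> 0" and "q \<noteq> 0"
    and "\<And>n::nat. n \<ge> 1 \<Longrightarrow> y \<noteq> - (q powi (- int n)) / x"
    and "\<And>n::nat. n \<ge> 1 \<Longrightarrow> y \<noteq> z * q powi (- int n) / x"
    and "m \<ge> 2"
  shows "(\<lambda>n. x ^ n * q ^ (n * (n + 1) div 2 + m * n) * qpoch (- z) q n
            / (qpoch (- x * y * q) q (m + n) * qpoch q q n))
          sums (Phi (x * q ^ m) y z q / qpoch (- x * y * q) q m)
      \<and> Phi (x * q ^ m) y z q / qpoch (- x * y * q) q m
          = (g m x y z q * Phi (x * q) y z q / (1 + x * y * q)
              - g (m - 1) (x * q) y z q * Phi x y z q)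
            / (\<Prod>j=1..m - 1. x\<^sup>2 * y * q ^ (2 * j + 1) - x * z * q ^ j)"
proof
  show "(\<lambda>n. x ^ n * q ^ (n * (n + 1) div 2 + m * n) * qpoch (- z) q n
            / (qpoch (- x * y * q) q (m + n) * qpoch q q n))
          sums (Phi (x * q ^ m) y z q / qpoch (- x * y * q) q m)"
    by (rule Phi_shift_sums[OF assms(1)])
next
  have nz: "1 + x * y * q ^ n \<noteq> 0" if "n \<ge> 1" for n
  proof
    assume "1 + x * y * q ^ n = 0"
    then have "y * (x * q ^ n) = - 1"
      by (simp add: eq_neg_iff_add_eq_0 mult_ac add_ac)
    then have "y = - (q powi (- int n)) / x"
      using assms(2,3) by (simp add: power_int_minus field_simps)
    then show False using assms(4)[OF that] by blast
  qed
  have c: "x\<^sup>2 * y * q ^ (2 * j + 1) - x * z * q ^ j \<noteq> 0" for j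
  proof
    assume "x\<^sup>2 * y * q ^ (2 * j + 1) - x * z * q ^ j = 0"
    \<comment> \<open>Factoring out \<open>x * q ^ j\<close> leaves the exponent
      \<open>j + 1 \<ge> 1\<close>, which the assumption on \<open>z\<close> excludes.\<close>
    then have "x * q ^ j * (x * y * q ^ Suc j - z) = 0"
      by (simp add: power2_eq_square power_add mult_2 mult_2_right algebra_simps)
    then have "z = x * y * q ^ Suc j"
      using assms(2,3) by simp
    then have "y = z * q powi (- int (Suc j)) / x"
      using assms(2,3) by (simp add: power_int_minus del: of_nat_Suc power_Suc)
    then show False using assms(5)[of "Suc j"] by simp
  qed
  obtain k where m: "m = Suc k"
    using assms(6) by (cases m) auto
  have "qpoch (- x * y * q) q 1 = 1 + x * y * q"
    by (simp add: qpoch_def)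
  then have "(\<Prod>j=1..k. x\<^sup>2 * y * q ^ (2 * j + 1) - x * z * q ^ j)
      * (Phi (x * q ^ m) y z q / qpoch (- x * y * q) q m)
    = g m x y z q * Phi (x * q) y z q / (1 + x * y * q) - g (m - 1) (x * q) y z q * Phi x y z q"
    using Phi_shift_eq[OF assms(1) nz, of z k] by (simp add: m)
  moreover have "(\<Prod>j=1..k. x\<^sup>2 * y * q ^ (2 * j + 1) - x * z * q ^ j) \<noteq> 0"
    using c by (simp add: prod_zero_iff)
  ultimately show "Phi (x * q ^ m) y z q / qpoch (- x * y * q) q m
          = (g m x y z q * Phi (x * q) y z q / (1 + x * y * q)
              - g (m - 1) (x * q) y z q * Phi x y z q)
            / (\<Prod>j=1..m - 1. x\<^sup>2 * y * q ^ (2 * j + 1) - x * z * q ^ j)"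
    by (simp add: m eq_divide_eq mult_ac)
qed

end
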